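(* Let $A\in\mathcal{K}$ be a Koch type set. If $\mathcal{H}^1(\Lambda_\infty)=0$, then $A$ is countably $1$-rectifiable.
   Context: A set $M\subset\mathbb{R}^2$ is countably $1$-rectifiable if $M\subset M_0\cup\bigcup_{j=1}^\infty F_j(\mathbb{R})$ with $\mathcal{H}^1(M_0)=0$ and $F_j:\mathbb{R}\to\mathbb{R}^2$ Lipschitz. A triangular cap on a segment is a closed solid isosceles triangle having that segment as base; its base angle is either of its two equal angles. Koch type sets: let $A_{0,1}\subset\mathbb{R}^2$ be a segment of finite positive length, and $T_{0,1}$ a triangular cap on it of height $\varepsilon\mathcal{H}^1(A_{0,1})$ with $0<\varepsilon<1/100$ and base angle $\theta_{0,1}$. Inductively, given caps $T_{n,i}$ on segments $A_{n,i}$ with base angles $\theta_{n,i}$ ($1\le i\le2^n$), let $A_{n+1,2i-1},A_{n+1,2i}$ be the two edges of $T_{n,i}$ other than its base, numbered so that $A_{n+1,1},\dots,A_{n+1,2^{n+1}}$ are consecutive segments of a polygonal curve joining the end points of $A_{0,1}$ (always starting from the same end point), and for $k\in\{2i-1,2i\}$ let $T_{n+1,k}\subset T_{n,i}$ be a triangular cap on $A_{n+1,k}$ with base angle $\theta_{n+1,k}\le\theta_{n,i}$. Let $B=\bigcap_{n=0}^\infty\bigcup_{i=1}^{2^n}T_{n,i}$ and let $E(B)$ be the set of all vertices of all $T_{n,i}$. A Koch type set is any set $A\in\{B,B\setminus E(B)\}$ arising in this way; $\mathcal{K}$ is the collection of all of them. For $x\in B$ let $i(n,x)$ be the index $i$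 with $x\in T_{n,i}$ (the larger one if there are two, which happens only for $x\in E(B)$), and $\tilde\Pi(x)=\prod_{n=0}^\infty(\cos\theta_{n,i(n,x)})^{-1}\in[1,\infty]$. Set $\Lambda_\infty=\{x\in A:\tilde\Pi(x)=\infty\}$. *)

theory Defs
  imports "HOL-Analysis.Analysis"
begin

section \<open>Hausdorff measure and rectifiability\<close>

text \<open>
  The one-dimensional Hausdorff outer measure, normalised so that a segment has its length as
  measure. The boundedness requirement is needed because \<^const>\<open>diameter\<close> is only meaningful on
  bounded sets. Finite covers are included, as sets of the sequence may be empty.
\<close>

definition hausdorff1_pre :: "real \<Rightarrow> 'a::metric_space set \<Rightarrow> ennreal" where
  "hausdorff1_pre \<delta> S =
    (INF U \<in> {U :: nat \<Rightarrow> 'a set. S \<subseteq> (\<Union>j. U j) \<and> (\<forall>j. bounded (U j) \<and> diameter (U j) \<le> \<delta>)}.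
      (\<Sum>j. ennreal (diameter (U j))))"

definition hausdorff1 :: "'a::metric_space set \<Rightarrow> ennreal" where
  "hausdorff1 S = (SUP \<delta>\<in>{0<..}. hausdorff1_pre \<delta> S)"

definition countably_1_rectifiable :: "(real^2) set \<Rightarrow> bool" where
  "countably_1_rectifiable M \<longleftrightarrow>
    (\<exists>M\<^sub>0 (F :: nat \<Rightarrow> real \<Rightarrow> real^2).
       M \<subseteq> M\<^sub>0 \<union> (\<Union>j. range (F j)) \<and> hausdorff1 M\<^sub>0 = 0 \<and>
       (\<forall>j. \<exists>L. L-lipschitz_on UNIV (F j)))"

section \<open>Triangular caps\<close>

text \<open>
  A triangular cap on \<open>closed_segment a b\<close> is \<open>convex hull {a, b, c}\<close> for an apex \<open>c\<close> as follows.
\<close>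

definition cap_apex :: "real^2 \<Rightarrow> real^2 \<Rightarrow> real^2 \<Rightarrow> bool" where
  "cap_apex a b c \<longleftrightarrow> \<not> collinear {a, b, c} \<and> dist a c = dist b c"

definition cap_height :: "real^2 \<Rightarrow> real^2 \<Rightarrow> real^2 \<Rightarrow> real" where
  "cap_height a b c = infdist c (affine hull {a, b})"

text \<open>The angle of the triangle with vertices \<open>a\<close>, \<open>b\<close>, \<open>c\<close> at its vertex \<open>a\<close>.\<close>

definition base_angle :: "real^2 \<Rightarrow> real^2 \<Rightarrow> real^2 \<Rightarrow> real" where
  "base_angle a b c = arccos (((b - a) \<bullet> (c - a)) / (norm (b - a) * norm (c - a)))"

section \<open>Koch type sets\<close>

text \<open>
  A construction is encoded by the vertices of its polygonal curves: \<open>p n 0, \<dots>, p n (2 ^ n)\<close> are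
  the consecutive vertices of the curve of generation \<open>n\<close>, so that its segments are indexed by
  \<open>1 \<le> i \<le> 2 ^ n\<close>. The two edges replacing segment \<open>i\<close> in generation \<open>n + 1\<close> are the segments
  \<open>2 * i - 1\<close> and \<open>2 * i\<close>; their common end point \<open>p (Suc n) (2 * i - 1)\<close> is the apex of the cap
  on segment \<open>i\<close>. All other values of \<open>p\<close> are irrelevant.
\<close>

definition koch_segment :: "(nat \<Rightarrow> nat \<Rightarrow> real^2) \<Rightarrow> nat \<Rightarrow> nat \<Rightarrow> (real^2) set" where
  "koch_segment p n i = closed_segment (p n (i - 1)) (p n i)"

definition koch_apex :: "(nat \<Rightarrow> nat \<Rightarrow> real^2) \<Rightarrow> nat \<Rightarrow> nat \<Rightarrow> real^2" where
  "koch_apex p n i = p (Suc n) (2 * i - 1)"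

definition koch_cap :: "(nat \<Rightarrow> nat \<Rightarrow> real^2) \<Rightarrow> nat \<Rightarrow> nat \<Rightarrow> (real^2) set" where
  "koch_cap p n i = convex hull {p n (i - 1), p n i, koch_apex p n i}"

definition koch_angle :: "(nat \<Rightarrow> nat \<Rightarrow> real^2) \<Rightarrow> nat \<Rightarrow> nat \<Rightarrow> real" where
  "koch_angle p n i = base_angle (p n (i - 1)) (p n i) (koch_apex p n i)"

definition koch_construction :: "(nat \<Rightarrow> nat \<Rightarrow> real^2) \<Rightarrow> bool" where
  "koch_construction p \<longleftrightarrow>
    p 0 0 \<noteq> p 0 1 \<and>
    (\<exists>\<epsilon>::real. 0 < \<epsilon> \<and> \<epsilon> < 1/100 \<and>
       ennreal (cap_height (p 0 0) (p 0 1) (koch_apex p 0 1))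
         = ennreal \<epsilon> * hausdorff1 (koch_segment p 0 1)) \<and>
    (\<forall>n. \<forall>i\<in>{1..2^n}. cap_apex (p n (i - 1)) (p n i) (koch_apex p n i)) \<and>
    (\<forall>n. \<forall>i\<in>{0..2^n}. p (Suc n) (2 * i) = p n i) \<and>
    (\<forall>n. \<forall>i\<in>{1..2^n}. \<forall>k\<in>{2 * i - 1, 2 * i}.
       koch_cap p (Suc n) k \<subseteq> koch_cap p n i \<and> koch_angle p (Suc n) k \<le> koch_angle p n i)"

definition koch_limit :: "(nat \<Rightarrow> nat \<Rightarrow> real^2) \<Rightarrow> (real^2) set" where
  "koch_limit p = (\<Inter>n. \<Union>i\<in>{1..2^n}. koch_cap p n i)"

definition koch_vertices :: "(nat \<Rightarrow> nat \<Rightarrow> real^2) \<Rightarrow> (real^2) set" where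
  "koch_vertices p = (\<Union>n. \<Union>i\<in>{1..2^n}. {p n (i - 1), p n i, koch_apex p n i})"

definition koch_type_set :: "(nat \<Rightarrow> nat \<Rightarrow> real^2) \<Rightarrow> (real^2) set \<Rightarrow> bool" where
  "koch_type_set p A \<longleftrightarrow>
    koch_construction p \<and> A \<in> {koch_limit p, koch_limit p - koch_vertices p}"

definition koch_index :: "(nat \<Rightarrow> nat \<Rightarrow> real^2) \<Rightarrow> nat \<Rightarrow> real^2 \<Rightarrow> nat" where
  "koch_index p n x = Max {i \<in> {1..2^n}. x \<in> koch_cap p n i}"

text \<open>
  The infinite product is taken in \<^typ>\<open>ennreal\<close>, so that divergence to infinity means that the
  value is \<open>\<infinity>\<close>; see \<open>prodinf_ennreal_eq_SUP\<close> below.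
\<close>

definition koch_product :: "(nat \<Rightarrow> nat \<Rightarrow> real^2) \<Rightarrow> real^2 \<Rightarrow> ennreal" where
  "koch_product p x = (\<Prod>n. ennreal (inverse (cos (koch_angle p n (koch_index p n x)))))"

definition koch_Lambda_infinity :: "(nat \<Rightarrow> nat \<Rightarrow> real^2) \<Rightarrow> (real^2) set \<Rightarrow> (real^2) set" where
  "koch_Lambda_infinity p A = {x \<in> A. koch_product p x = \<infinity>}"

lemma prodinf_ennreal_eq_SUP:
  fixes f :: "nat \<Rightarrow> ennreal"
  assumes ge1: "\<And>n. 1 \<le> f n"
  shows "prodinf f = (SUP n. \<Prod>i\<le>n. f i)"
proof -
  let ?P = "\<lambda>n. \<Prod>i\<le>n. f i"
  have "incseq ?P"
  proof (rule incseq_SucI)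
    fix n
    have "?P n * 1 \<le> ?P n * f (Suc n)"
      by (intro mult_left_mono ge1) simp
    then show "?P n \<le> ?P (Suc n)" by simp
  qed
  then have lim: "?P \<longlonglongrightarrow> (SUP n. ?P n)" by (rule LIMSEQ_SUP)
  have "1 \<le> ?P 0" using ge1 by simp
  also have "\<dots> \<le> (SUP n. ?P n)" by (rule SUP_upper) simp
  finally have "(SUP n. ?P n) \<noteq> 0" by (metis not_one_le_zero)
  with lim have ex: "f has_prod (SUP n. ?P n)"
    by (simp add: has_prod_def raw_has_prod_def)
  have nz: "f n \<noteq> 0" for n using ge1[of n] by (metis not_one_le_zero)
  have "q = (SUP n. ?P n)" if "f has_prod q" for q
  proof -
    have "?P \<longlonglongrightarrow> q"
      using that nz unfolding has_prod_def raw_has_prod_def by simp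
    then show ?thesis using lim by (rule LIMSEQ_unique)
  qed
  with ex show ?thesis unfolding prodinf_def by (rule the_equality)
qed

end

theory Submission
  imports Defs
begin

text \<open>
  Isosceles trigonometry turns the partial products of \<open>1 / cos \<theta>\<close> into the segment lengths
  multiplied by \<open>2 ^ n\<close>. Hence the points of \<open>A\<close> outside \<open>\<Lambda>\<^sub>\<infinity>\<close> are a countable union, over \<open>K\<close>, of
  the sets of points all of whose segments have length at most \<open>K / 2 ^ n\<close>. If the construction
  is stopped on every segment whose descendants would violate this bound, and such a segment is
  merely bisected, then the dyadically parametrised polygons are \<open>K\<close>-Lipschitz, and their limit
  curve passes through all points of the set with index \<open>K\<close>.

  That the segments containing a point form a branch of the binary tree depends on the angles being
  small: sibling caps are separated by the line through their common apex orthogonal to the base.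
\<close>

section \<open>Hausdorff measure of a segment\<close>

text \<open>Cutting the segment into \<open>N\<close> equal pieces of diameter at most
  \<open>\<delta>\<close> gives a cover of total length \<open>dist a b\<close>. This turns the
  height condition on the first cap, which is stated with \<open>hausdorff1\<close>, into one on
  distances.\<close>

lemma hausdorff1_closed_segment_le:
  fixes a b :: "'a::real_normed_vector"
  shows "hausdorff1 (closed_segment a b) \<le> ennreal (dist a b)"
  unfolding hausdorff1_def
proof (rule SUP_least)
  fix \<delta> :: real
  assume "\<delta> \<in> {0<..}"
  then have "\<delta> > 0" by simp
  obtain N :: nat where N: "dist a b / \<delta> < real N"
    using reals_Archimedean2 by blast
  have N0: "N > 0"
    using N \<open>\<delta> > 0\<close> by (metis divide_nonneg_pos gr0I less_le_not_le of_nat_0 zero_le_dist)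
  have le: "dist a b / real N \<le> \<delta>"
    using N N0 \<open>\<delta> > 0\<close> by (simp add: field_simps)
  define S where "S j = (\<lambda>t. a + t *\<^sub>R (b - a)) ` {real j / N .. real (Suc j) / N}" for j
  define U where "U j = (if j < N then S j else {})" for j
  have dS: "dist x y \<le> dist a b / N" if "x \<in> S j" "y \<in> S j" for x y j
  proof -
    obtain s t where st: "x = a + s *\<^sub>R (b - a)" "y = a + t *\<^sub>R (b - a)"
      "real j / N \<le> s" "s \<le> real (Suc j) / N" "real j / N \<le> t" "t \<le> real (Suc j) / N"
      using \<open>x \<in> S j\<close> \<open>y \<in> S j\<close> unfolding S_def image_iff Bex_def atLeastAtMost_iff by blast
    have "real (Suc j) / N = real j / N + 1 / N" by (simp add: add_divide_distrib)
    then have "\<bar>s - t\<bar> \<le> 1 / N" using st by linarith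
    moreover have "dist x y = \<bar>s - t\<bar> * norm (b - a)"
      using st by (simp add: dist_norm flip: scaleR_diff_left)
    ultimately have "dist x y \<le> 1 / N * norm (b - a)"
      by (simp add: mult_right_mono del: times_divide_eq_left)
    then show ?thesis by (simp add: dist_norm norm_minus_commute)
  qed
  have dU: "dist x y \<le> dist a b / N" if "x \<in> U j" "y \<in> U j" for x y j
    using dS that unfolding U_def by (auto split: if_splits)
  have diam: "diameter (U j) \<le> dist a b / N" for j
    using dU by (intro diameter_le) (auto simp: dist_norm)
  have "closed_segment a b \<subseteq> (\<Union>j. U j)"
  proof
    fix x
    assume "x \<in> closed_segment a b"
    then obtain t where t: "0 \<le> t" "t \<le> 1" and x: "x = (1 - t) *\<^sub>R a + t *\<^sub>R b"
      unfolding closed_segment_def by blast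
    \<comment> \<open>The minimum puts the end point \<open>t = 1\<close> into the last
      piece.\<close>
    define j where "j = min (N - 1) (nat \<lfloor>t * N\<rfloor>)"
    have "t * N \<le> N" using t by (simp add: mult_left_le_one_le)
    have "real j \<le> t * N \<and> t * N \<le> real (Suc j)"
    proof (cases "nat \<lfloor>t * N\<rfloor> < N")
      case True
      then have "j = nat \<lfloor>t * N\<rfloor>" unfolding j_def by simp
      then have "real j = real_of_int \<lfloor>t * N\<rfloor>" using t by simp
      then show ?thesis by simp linarith
    next
      case False
      then have j: "j = N - 1" unfolding j_def by simp
      have "real N \<le> t * N" using False t N0 by (simp add: le_nat_iff le_floor_iff not_less)
      then show ?thesis using j N0 \<open>t * N \<le> N\<close> by simp
    qed
    then have "t \<in> {real j / N .. real (Suc j) / N}"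
      using N0 by (simp add: field_simps)
    moreover have "x = a + t *\<^sub>R (b - a)" using x by (simp add: algebra_simps)
    ultimately have "x \<in> S j" unfolding S_def by blast
    moreover have "j < N" unfolding j_def using N0 by auto
    ultimately show "x \<in> (\<Union>j. U j)" unfolding U_def by auto
  qed
  moreover have "bounded (U j) \<and> diameter (U j) \<le> \<delta>" for j
    using diam[of j] le dU[of _ j] unfolding bounded_two_points by (meson order_trans)
  ultimately have "hausdorff1_pre \<delta> (closed_segment a b) \<le> (\<Sum>j. ennreal (diameter (U j)))"
    unfolding hausdorff1_pre_def by (intro INF_lower) auto
  also have "\<dots> = (\<Sum>j<N. ennreal (diameter (U j)))"
    by (rule suminf_finite) (auto simp: U_def)
  also have "\<dots> \<le> (\<Sum>j<N. ennreal (dist a b / N))"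
    using diam by (intro sum_mono ennreal_leI)
  also have "\<dots> = ennreal (dist a b)"
    using N0 by (simp add: ennreal_of_nat_eq_real_of_nat flip: ennreal_mult')
  finally show "hausdorff1_pre \<delta> (closed_segment a b) \<le> ennreal (dist a b)" .
qed

section \<open>Triangular caps\<close>

lemma cap_apex_commute: "cap_apex a b c \<longleftrightarrow> cap_apex b a c"
  unfolding cap_apex_def insert_commute[of a b] by auto

lemma cap_apex_distinct:
  assumes "cap_apex a b c"
  shows "a \<noteq> b" "a \<noteq> c" "b \<noteq> c"
  using assms unfolding cap_apex_def insert_commute[of a b] by auto

text \<open>The apex projects orthogonally to the midpoint of the base.\<close>

lemma cap_apex_inner:
  assumes "cap_apex a b c"
  shows "(b - a) \<bullet> (c - a) = (dist a b)\<^sup>2 / 2"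
proof -
  have "(norm (c - a))\<^sup>2 = (norm (c - b))\<^sup>2"
    using assms unfolding cap_apex_def by (simp add: dist_norm norm_minus_commute)
  then show ?thesis
    by (simp add: dist_norm norm_minus_commute power2_norm_eq_inner inner_diff inner_commute algebra_simps)
qed

lemma base_angle_quotient_bounds:
  assumes "cap_apex a b c"
  shows "- 1 \<le> ((b - a) \<bullet> (c - a)) / (norm (b - a) * norm (c - a))"
    and "((b - a) \<bullet> (c - a)) / (norm (b - a) * norm (c - a)) \<le> 1"
proof -
  have "\<bar>((b - a) \<bullet> (c - a)) / (norm (b - a) * norm (c - a))\<bar> \<le> 1"
    using Cauchy_Schwarz_ineq2[of "b - a" "c - a"] cap_apex_distinct[OF assms] by (simp add: abs_mult)
  then show "- 1 \<le> ((b - a) \<bullet> (c - a)) / (norm (b - a) * norm (c - a))"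
    "((b - a) \<bullet> (c - a)) / (norm (b - a) * norm (c - a)) \<le> 1"
    unfolding abs_le_iff by linarith+
qed

text \<open>Half the base over the leg: this formula translates angles into ratios of consecutive
  segment lengths.\<close>

lemma cos_base_angle:
  assumes "cap_apex a b c"
  shows "cos (base_angle a b c) = dist a b / (2 * dist a c)"
proof -
  note d = cap_apex_distinct[OF assms]
  let ?r = "((b - a) \<bullet> (c - a)) / (norm (b - a) * norm (c - a))"
  have "cos (base_angle a b c) = ?r"
    unfolding base_angle_def using base_angle_quotient_bounds[OF assms] by (intro cos_arccos)
  also have "\<dots> = dist a b / (2 * dist a c)"
    using d unfolding cap_apex_inner[OF assms]
    by (simp add: dist_norm norm_minus_commute power2_eq_square field_simps)
  finally show ?thesis .
qed

lemma cos_base_angle_antimono: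
  assumes "cap_apex a b c" "cap_apex a' b' c'" "base_angle a b c \<le> base_angle a' b' c'"
  shows "cos (base_angle a' b' c') \<le> cos (base_angle a b c)"
proof -
  have "0 \<le> base_angle a b c \<and> base_angle a b c \<le> pi" if "cap_apex a b c" for a b c :: "real^2"
    unfolding base_angle_def using base_angle_quotient_bounds[OF that] arccos_lbound arccos_ubound by blast
  with assms show ?thesis by (intro cos_monotone_0_pi_le) auto
qed

text \<open>The squared norm of \<open>v - w\<close> is at most \<open>1/2\<close>, hence below
  \<open>9/16\<close>, so replacing \<open>w\<close> by \<open>v\<close> changes the inner product
  with \<open>u\<close> by less than \<open>3/4\<close>.\<close>

lemma inner_neg_of_nearly_opposite:
  fixes u v w :: "'a::real_inner"
  assumes "norm u = 1" "norm v = 1" "norm w = 1" "3/4 \<le> v \<bullet> w" "w \<bullet> u \<le> - (3/4)"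
  shows "v \<bullet> u < 0"
proof -
  have "(norm (v - w))\<^sup>2 = 2 - 2 * (v \<bullet> w)"
    using assms by (simp add: power2_norm_eq_inner inner_diff inner_commute norm_eq_1)
  then have "(norm (v - w))\<^sup>2 < (3/4)\<^sup>2"
    using assms by (simp add: power2_eq_square)
  then have "norm (v - w) < 3/4" by (rule power_less_imp_less_base) simp
  moreover have "(v - w) \<bullet> u \<le> norm (v - w)"
    using norm_cauchy_schwarz[of "v - w" u] assms by simp
  ultimately show ?thesis using assms by (simp add: inner_diff_left)
qed

text \<open>The vector \<open>d - c\<close> makes the child's base angle with \<open>a - c\<close>,
  which in turn makes the parent's base angle with \<open>a - b\<close>. Both angles are small, so
  \<open>d\<close> stays on the side of \<open>a\<close> of the line through \<open>c\<close>
  orthogonal to the base, whichever side of its own base the child cap is on.\<close>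

lemma child_apex_inner_neg:
  assumes abc: "cap_apex a b c" and acd: "cap_apex a c d"
    and "3/4 \<le> dist a b / (2 * dist a c)" "3/4 \<le> dist a c / (2 * dist a d)"
  shows "(d - c) \<bullet> (b - a) < 0"
proof -
  note d = cap_apex_distinct[OF abc] cap_apex_distinct[OF acd]
  have "(a - c) \<bullet> (d - c) = (dist a c)\<^sup>2 / 2"
    using cap_apex_inner[of c a d] acd cap_apex_commute by (metis dist_commute)
  then have "sgn (d - c) \<bullet> sgn (a - c) = ((dist a c)\<^sup>2 / 2) / (dist a d * dist a c)"
    using acd unfolding cap_apex_def sgn_div_norm inner_scaleR_left inner_scaleR_right
    by (simp add: dist_norm norm_minus_commute inner_commute divide_simps)
  then have 1: "sgn (d - c) \<bullet> sgn (a - c) = dist a c / (2 * dist a d)"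
    using d by (simp add: power2_eq_square)
  have "(a - c) \<bullet> (b - a) = - ((dist a b)\<^sup>2 / 2)"
    using cap_apex_inner[OF abc] by (simp add: inner_diff inner_commute algebra_simps)
  then have "sgn (a - c) \<bullet> sgn (b - a) = - ((dist a b)\<^sup>2 / 2) / (dist a c * dist a b)"
    unfolding sgn_div_norm inner_scaleR_left inner_scaleR_right
    by (simp add: dist_norm norm_minus_commute divide_simps)
  then have 2: "sgn (a - c) \<bullet> sgn (b - a) = - (dist a b / (2 * dist a c))"
    using d by (simp add: power2_eq_square)
  have "sgn (d - c) \<bullet> sgn (b - a) < 0"
    using d assms(3,4) 1 2
    by (intro inner_neg_of_nearly_opposite[where w = "sgn (a - c)"]) (auto simp: norm_sgn)
  then show ?thesis
    using d unfolding sgn_div_norm inner_scaleR_left inner_scaleR_right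
    by (simp add: mult_less_0_iff zero_less_mult_iff)
qed

text \<open>Seen from \<open>c\<close>, the triangle consists of nonnegative combinations of two
  vectors with negative inner product with \<open>z\<close>; only \<open>c\<close> itself has both
  coefficients zero.\<close>

lemma hull_of_3_strictly_below:
  fixes a c d x z :: "'a::real_inner"
  assumes "(a - c) \<bullet> z < 0" "(d - c) \<bullet> z < 0" and "x \<in> convex hull {a, c, d}"
  shows "x = c \<or> (x - c) \<bullet> z < 0"
proof -
  obtain u v w where uvw: "0 \<le> u" "0 \<le> v" "0 \<le> w" "u + v + w = 1"
    and x: "x = u *\<^sub>R a + v *\<^sub>R c + w *\<^sub>R d"
    using assms(3) unfolding convex_hull_3 by blast
  have v: "v = 1 - u - w" using uvw by simp
  have x: "x - c = u *\<^sub>R (a - c) + w *\<^sub>R (d - c)"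
    unfolding x v by (simp add: algebra_simps)
  show ?thesis
  proof (cases "u = 0 \<and> w = 0")
    case True
    then show ?thesis using x by simp
  next
    case False
    have "(x - c) \<bullet> z = u * ((a - c) \<bullet> z) + w * ((d - c) \<bullet> z)"
      using x by (simp add: inner_add_left)
    moreover have "u * ((a - c) \<bullet> z) \<le> 0" "w * ((d - c) \<bullet> z) \<le> 0"
      using uvw assms by (auto simp: mult_le_0_iff)
    moreover have "u * ((a - c) \<bullet> z) < 0 \<or> w * ((d - c) \<bullet> z) < 0"
      using uvw assms False by (auto simp: mult_less_0_iff)
    ultimately show ?thesis by linarith
  qed
qed

lemma sibling_caps_Int:
  assumes abc: "cap_apex a b c" and acd: "cap_apex a c d" and cbe: "cap_apex c b e"
    and "3/4 \<le> dist a b / (2 * dist a c)" "3/4 \<le> dist a c / (2 * dist a d)"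
      "3/4 \<le> dist c b / (2 * dist c e)"
  shows "convex hull {a, c, d} \<inter> convex hull {c, b, e} \<subseteq> {c}"
proof
  fix x
  assume x: "x \<in> convex hull {a, c, d} \<inter> convex hull {c, b, e}"
  have "dist a c = dist b c" using abc unfolding cap_apex_def by simp
  have "(a - c) \<bullet> (b - a) = - (dist a b)\<^sup>2 / 2" "(b - c) \<bullet> (a - b) = - (dist a b)\<^sup>2 / 2"
    using cap_apex_inner[OF abc] cap_apex_inner[of b a c] abc cap_apex_commute[of a b]
    by (simp_all add: inner_diff inner_commute dist_commute algebra_simps)
  then have "(a - c) \<bullet> (b - a) < 0" "(b - c) \<bullet> (a - b) < 0"
    using cap_apex_distinct[OF abc] by simp_all
  moreover have "(d - c) \<bullet> (b - a) < 0"
    using assms by (intro child_apex_inner_neg)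
  \<comment> \<open>The mirror image, with the base read from \<open>b\<close> to
    \<open>a\<close>.\<close>
  moreover have "(e - c) \<bullet> (a - b) < 0"
    using assms \<open>dist a c = dist b c\<close> cap_apex_commute
    by (intro child_apex_inner_neg) (auto simp: cap_apex_def dist_commute)
  ultimately have "x = c \<or> (x - c) \<bullet> (b - a) < 0" "x = c \<or> (x - c) \<bullet> (a - b) < 0"
    using x hull_of_3_strictly_below[of a c "b - a" d x] hull_of_3_strictly_below[of b c "a - b" e x]
    by (auto simp: insert_commute)
  then show "x \<in> {c}" by (auto simp: inner_diff_right)
qed

text \<open>The midpoint of the base is the point of the base line nearest to the apex, so the leg
  is at most half the base plus the height.\<close>

lemma cap_apex_dist_le:
  assumes "cap_apex a b c" and "cap_height a b c < h"
  shows "dist a c \<le> dist a b / 2 + h"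
proof -
  let ?m = "midpoint a b"
  obtain q where q: "q \<in> affine hull {a, b}" "dist c q < h"
    using assms(2) unfolding cap_height_def
    by (metis affine_hull_eq_empty infdist_attains_inf closed_affine_hull insert_not_empty)
  obtain u v where uv: "u + v = 1" "q = u *\<^sub>R a + v *\<^sub>R b"
    using q(1) unfolding affine_hull_2 by blast
  then have u: "u = 1 - v" by simp
  have "?m = (1/2) *\<^sub>R a + (1/2) *\<^sub>R b" by (simp add: midpoint_def scaleR_add_right)
  then have mq: "?m - q = (1/2 - v) *\<^sub>R (b - a)"
    unfolding uv(2) u by (simp add: scaleR_diff_left scaleR_diff_right)
  have "(c - ?m) \<bullet> (b - a) = (c - a) \<bullet> (b - a) - (1/2) * ((b - a) \<bullet> (b - a))"
    unfolding midpoint_def by (simp add: inner_diff inner_add inner_commute algebra_simps)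
  also have "\<dots> = 0"
    using cap_apex_inner[OF assms(1)]
    by (simp add: inner_commute dist_norm norm_minus_commute[of a b] flip: power2_norm_eq_inner)
  finally have orth: "(c - ?m) \<bullet> (?m - q) = 0" unfolding mq by simp
  have "(norm (c - q))\<^sup>2 = (norm (c - ?m))\<^sup>2 + (norm (?m - q))\<^sup>2"
    using norm_add_Pythagorean[of "c - ?m" "?m - q"] orth by (simp add: orthogonal_def)
  then have "(norm (c - ?m))\<^sup>2 \<le> (norm (c - q))\<^sup>2" by simp
  then have "norm (c - ?m) \<le> norm (c - q)" by (rule power2_le_imp_le) simp
  then have "dist ?m c \<le> h"
    using q(2) by (simp add: dist_norm norm_minus_commute)
  moreover have "dist a ?m = dist a b / 2" by (simp add: dist_midpoint)
  ultimately show ?thesis using dist_triangle[of a c ?m] by linarith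
qed

section \<open>Lipschitz limits of dyadic polygons\<close>

text \<open>The point \<open>q n i\<close> is the position at time \<open>i / 2 ^ n\<close>.
  Refinement moves the position at a fixed time by a geometrically decreasing amount, which gives
  convergence; generation \<open>n\<close> is \<open>K\<close>-Lipschitz up to a rounding error that
  vanishes in the limit. Negative times are sent to index 0 by \<open>nat\<close>.\<close>

lemma Lipschitz_dyadic_limit:
  fixes q :: "nat \<Rightarrow> nat \<Rightarrow> 'a::complete_space"
  assumes even: "\<And>n i. q (Suc n) (2 * i) = q n i"
    and step: "\<And>n i. dist (q n i) (q n (Suc i)) \<le> K / 2 ^ n"
  obtains g where "K-lipschitz_on UNIV g"
    and "\<And>t::real. (\<lambda>n. q n (nat \<lfloor>2 ^ n * t\<rfloor>)) \<longlonglongrightarrow> g t"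
proof -
  define f where "f n t = q n (nat \<lfloor>2 ^ n * t\<rfloor>)" for n and t :: real
  have K: "0 \<le> K" using order_trans[OF zero_le_dist step[of 0 0]] by simp
  have dist_le: "dist (q n i) (q n j) \<le> \<bar>real i - real j\<bar> * (K / 2 ^ n)" for n i j
  proof -
    have add: "dist (q n i) (q n (i + k)) \<le> real k * (K / 2 ^ n)" for i k
    proof (induction k)
      case (Suc k)
      have "dist (q n i) (q n (i + Suc k)) \<le> dist (q n i) (q n (i + k)) + dist (q n (i + k)) (q n (Suc (i + k)))"
        using dist_triangle by simp
      also have "\<dots> \<le> real k * (K / 2 ^ n) + K / 2 ^ n" using Suc step by (intro add_mono)
      finally show ?case by (simp add: distrib_right add_divide_distrib)
    qed simp
    show ?thesis
    proof (cases "i \<le> j")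
      case True
      then show ?thesis using add[of i "j - i"] by simp
    next
      case False
      then show ?thesis using add[of j "i - j"] by (simp add: dist_commute)
    qed
  qed
  have f_Suc: "dist (f n t) (f (Suc n) t) \<le> K * (1/2) ^ n" for n t
  proof -
    let ?k = "nat \<lfloor>2 ^ n * t\<rfloor>" and ?l = "nat \<lfloor>2 ^ Suc n * t\<rfloor>"
    \<comment> \<open>The old sample is also the vertex \<open>2 * ?k\<close> of the finer polygon,
      hence at most one step away from the new sample.\<close>
    have "2 * \<lfloor>2 ^ n * t\<rfloor> \<le> \<lfloor>2 ^ Suc n * t\<rfloor> \<and> \<lfloor>2 ^ Suc n * t\<rfloor> \<le> 2 * \<lfloor>2 ^ n * t\<rfloor> + 1"
    proof -
      have "2 ^ Suc n * t = 2 * (2 ^ n * t)" by simp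
      then show ?thesis by linarith
    qed
    then have "\<bar>real (2 * ?k) - real ?l\<bar> \<le> 1" by linarith
    have "dist (f n t) (f (Suc n) t) = dist (q (Suc n) (2 * ?k)) (q (Suc n) ?l)"
      unfolding f_def even by simp
    also have "\<dots> \<le> \<bar>real (2 * ?k) - real ?l\<bar> * (K / 2 ^ Suc n)" by (rule dist_le)
    also have "\<dots> \<le> 1 * (K / 2 ^ Suc n)"
      using \<open>\<bar>real (2 * ?k) - real ?l\<bar> \<le> 1\<close> K by (intro mult_right_mono) auto
    also have "\<dots> \<le> K * (1/2) ^ n"
      using K by (simp add: power_one_over divide_simps)
    finally show ?thesis .
  qed
  \<comment> \<open>The right-hand side is the closed form of the geometric sum of the
    \<open>d\<close> single-step bounds.\<close>
  have f_add: "dist (f m t) (f (m + d) t) \<le> 2 * K * (1/2) ^ m * (1 - (1/2) ^ d)" for m d t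
  proof (induction d)
    case (Suc d)
    have "dist (f m t) (f (m + Suc d) t) \<le> dist (f m t) (f (m + d) t) + dist (f (m + d) t) (f (Suc (m + d)) t)"
      using dist_triangle by simp
    also have "\<dots> \<le> 2 * K * (1/2) ^ m * (1 - (1/2) ^ d) + K * (1/2) ^ (m + d)"
      by (intro add_mono Suc f_Suc)
    also have "\<dots> = 2 * K * (1/2) ^ m * (1 - (1/2) ^ Suc d)"
      by (simp add: algebra_simps power_add)
    finally show ?case .
  qed simp
  have "Cauchy (\<lambda>n. f n t)" for t
  proof (rule metric_CauchyI)
    fix e :: real
    assume "0 < e"
    have "(\<lambda>n. 2 * (2 * K * (1/2) ^ n)) \<longlonglongrightarrow> 0"
      by (intro tendsto_mult_right_zero LIMSEQ_realpow_zero) auto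
    from order_tendstoD(2)[OF this \<open>0 < e\<close>] obtain M where M: "2 * (2 * K * (1/2) ^ M) < e"
      unfolding eventually_sequentially by blast
    have "dist (f M t) (f m t) \<le> 2 * K * (1/2) ^ M" if "M \<le> m" for m
    proof -
      have "dist (f M t) (f m t) \<le> 2 * K * (1/2) ^ M * (1 - (1/2) ^ (m - M))"
        using f_add[of M t "m - M"] that by simp
      also have "\<dots> \<le> 2 * K * (1/2) ^ M" using K by (intro mult_left_le) auto
      finally show ?thesis .
    qed
    then have "dist (f m t) (f n t) < e" if "M \<le> m" "M \<le> n" for m n
      using dist_triangle3[of "f m t" "f n t" "f M t"] M that by (smt (verit))
    then show "\<exists>M. \<forall>m\<ge>M. \<forall>n\<ge>M. dist (f m t) (f n t) < e" by blast
  qed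
  then have "convergent (\<lambda>n. f n t)" for t
    by (simp add: Cauchy_convergent_iff)
  then obtain g where g: "(\<lambda>n. f n t) \<longlonglongrightarrow> g t" for t
    unfolding convergent_def by metis
  have "K-lipschitz_on UNIV g"
  proof (rule lipschitz_onI)
    fix s t :: real
    \<comment> \<open>Rounding both times down costs at most one extra step, of length
      \<open>K / 2 ^ n\<close>.\<close>
    have bound: "dist (f n s) (f n t) \<le> K * dist s t + K * (1/2) ^ n" for n
    proof -
      let ?k = "nat \<lfloor>2 ^ n * s\<rfloor>" and ?l = "nat \<lfloor>2 ^ n * t\<rfloor>"
      have "\<bar>real ?k - real ?l\<bar> \<le> \<bar>2 ^ n * s - 2 ^ n * t\<bar> + 1" by linarith
      also have "\<dots> = 2 ^ n * dist s t + 1"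
        by (simp add: dist_real_def abs_mult flip: right_diff_distrib)
      finally have "dist (f n s) (f n t) \<le> (2 ^ n * dist s t + 1) * (K / 2 ^ n)"
        unfolding f_def using K by (intro order_trans[OF dist_le] mult_right_mono) auto
      also have "\<dots> = K * dist s t + K * (1/2) ^ n"
        by (simp add: power_one_over field_simps)
      finally show ?thesis .
    qed
    have "(\<lambda>n. K * dist s t + K * (1/2) ^ n) \<longlonglongrightarrow> K * dist s t + K * 0"
      by (intro tendsto_intros LIMSEQ_realpow_zero) auto
    then show "dist (g s) (g t) \<le> K * dist s t"
      using bound by (intro LIMSEQ_le[OF tendsto_dist[OF g g]]) auto
  qed (rule K)
  then show ?thesis using that g unfolding f_def by blast
qed

text \<open>The indices describe nested dyadic intervals, and \<open>t\<close> is a point common to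
  all of them. The value \<open>Suc (k n)\<close> arises when \<open>t\<close> is the right end
  point of its interval.\<close>

lemma dyadic_path_point:
  fixes k :: "nat \<Rightarrow> nat"
  assumes "\<And>n. k (Suc n) \<in> {2 * k n, Suc (2 * k n)}"
  obtains t :: real where "\<And>n. nat \<lfloor>2 ^ n * t\<rfloor> \<in> {k n, Suc (k n)}"
proof -
  define l u where "l n = real (k n) / 2 ^ n" and "u n = (real (k n) + 1) / 2 ^ n" for n
  have k: "2 * real (k n) \<le> real (k (Suc n))" "real (k (Suc n)) \<le> 2 * real (k n) + 1" for n
    using assms[of n] by auto
  have "incseq l"
  proof (rule incseq_SucI)
    fix n
    show "l n \<le> l (Suc n)" unfolding l_def using k(1)[of n] by (simp add: divide_simps mult.commute)
  qed
  moreover have "decseq u"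
  proof (rule decseq_SucI)
    fix n
    show "u (Suc n) \<le> u n" unfolding u_def using k(2)[of n] by (simp add: divide_simps mult.commute)
  qed
  moreover have "l n \<le> u n" for n unfolding l_def u_def by (simp add: divide_simps)
  ultimately have lu: "l m \<le> u n" for m n
    using incseqD[of l m "max m n"] decseqD[of u n "max m n"] by (meson max.cobounded1 max.cobounded2 order_trans)
  define t where "t = (SUP n. l n)"
  have "l n \<le> t" for n unfolding t_def
    using lu[of _ 0] by (intro cSUP_upper bdd_aboveI2[of _ _ "u 0"]) auto
  moreover have "t \<le> u n" for n unfolding t_def using lu by (intro cSUP_least) auto
  ultimately have "real (k n) \<le> 2 ^ n * t \<and> 2 ^ n * t \<le> real (k n) + 1" for n
    unfolding l_def u_def by (simp add: field_simps)
  then have "nat \<lfloor>2 ^ n * t\<rfloor> \<in> {k n, Suc (k n)}" for n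
    by (smt (verit) floor_correct insert_iff nat_int of_int_less_iff of_int_of_nat_eq of_nat_Suc of_nat_less_iff nat_eq_iff le_floor_iff)
  then show ?thesis using that by blast
qed

section \<open>Koch constructions\<close>

text \<open>
  The facts below index the segments of generation \<open>n\<close> by \<open>i < 2 ^ n\<close>, so that segment \<open>i\<close> here
  is \<^term>\<open>koch_segment p n (Suc i)\<close>.
\<close>

lemma koch_vertex_even:
  assumes "koch_construction p" "i \<le> 2 ^ n"
  shows "p (Suc n) (2 * i) = p n i"
  using assms unfolding koch_construction_def by auto

lemma koch_cap_apex:
  assumes "koch_construction p" "i < 2 ^ n"
  shows "cap_apex (p n i) (p n (Suc i)) (p (Suc n) (Suc (2 * i)))"
proof -
  have "Suc i \<in> {1..2 ^ n}" using assms by auto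
  then have "cap_apex (p n (Suc i - 1)) (p n (Suc i)) (koch_apex p n (Suc i))"
    using assms(1) unfolding koch_construction_def by blast
  then show ?thesis by (simp add: koch_apex_def)
qed

lemma koch_cap_Suc: "koch_cap p n (Suc i) = convex hull {p n i, p n (Suc i), p (Suc n) (Suc (2 * i))}"
  by (simp add: koch_cap_def koch_apex_def)

lemma koch_child:
  assumes "koch_construction p" "i < 2 ^ n" "k \<in> {2 * i, Suc (2 * i)}"
  shows "koch_cap p (Suc n) (Suc k) \<subseteq> koch_cap p n (Suc i)"
    and "koch_angle p (Suc n) (Suc k) \<le> koch_angle p n (Suc i)"
proof -
  have "Suc i \<in> {1..2 ^ n}" "Suc k \<in> {2 * Suc i - 1, 2 * Suc i}" using assms by auto
  then show "koch_cap p (Suc n) (Suc k) \<subseteq> koch_cap p n (Suc i)"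
    "koch_angle p (Suc n) (Suc k) \<le> koch_angle p n (Suc i)"
    using assms(1) unfolding koch_construction_def by blast+
qed

text \<open>Both legs of a cap are equally long, so the length in the next generation does not
  depend on which child a branch takes.\<close>

lemma koch_child_dist:
  assumes "koch_construction p" "i < 2 ^ n" "k \<in> {2 * i, Suc (2 * i)}"
  shows "dist (p (Suc n) k) (p (Suc n) (Suc k)) = dist (p n i) (p (Suc n) (Suc (2 * i)))"
proof -
  have "p (Suc n) (2 * i) = p n i" "p (Suc n) (Suc (Suc (2 * i))) = p n (Suc i)"
    using koch_vertex_even[OF assms(1), of i n] koch_vertex_even[OF assms(1), of "Suc i" n] assms(2)
    by auto
  then show ?thesis
    using assms(3) koch_cap_apex[OF assms(1,2)] unfolding cap_apex_def by (auto simp: dist_commute)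
qed

lemma cos_koch_angle:
  assumes "koch_construction p" "i < 2 ^ n"
  shows "cos (koch_angle p n (Suc i)) = dist (p n i) (p n (Suc i)) / (2 * dist (p n i) (p (Suc n) (Suc (2 * i))))"
  using cos_base_angle[OF koch_cap_apex[OF assms]] by (simp add: koch_angle_def koch_apex_def)

text \<open>Angles do not increase from parent to child, so only the first cap matters. Its leg is
  at most \<open>1/2 + 1/100\<close> times its base, which makes the cosine at least
  \<open>1 / 1.02\<close>.\<close>

lemma cos_koch_angle_ge:
  assumes "koch_construction p" "i < 2 ^ n"
  shows "3/4 \<le> cos (koch_angle p n (Suc i))"
  using assms(2)
proof (induction n arbitrary: i)
  case 0
  then have i: "i = 0" by simp
  let ?a = "p 0 0" and ?b = "p 0 1" and ?c = "p 1 1"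
  have cap: "cap_apex ?a ?b ?c" using koch_cap_apex[OF assms(1), of 0 0] by simp
  obtain \<epsilon> :: real where \<epsilon>: "0 < \<epsilon>" "\<epsilon> < 1/100"
    "ennreal (cap_height ?a ?b ?c) = ennreal \<epsilon> * hausdorff1 (closed_segment ?a ?b)"
    using assms(1) unfolding koch_construction_def koch_apex_def koch_segment_def by auto
  note \<epsilon>(3)
  also have "ennreal \<epsilon> * hausdorff1 (closed_segment ?a ?b) \<le> ennreal \<epsilon> * ennreal (dist ?a ?b)"
    by (intro mult_left_mono hausdorff1_closed_segment_le) simp
  also have "\<dots> = ennreal (\<epsilon> * dist ?a ?b)" using \<epsilon> by (simp add: ennreal_mult)
  finally have "cap_height ?a ?b ?c \<le> \<epsilon> * dist ?a ?b" using \<epsilon> by simp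
  also have "\<dots> < 1/100 * dist ?a ?b"
    using \<epsilon> cap_apex_distinct[OF cap] by (intro mult_strict_right_mono) auto
  finally have "dist ?a ?c \<le> dist ?a ?b / 2 + 1/100 * dist ?a ?b"
    using cap by (intro cap_apex_dist_le) auto
  then have "3/4 \<le> dist ?a ?b / (2 * dist ?a ?c)"
    using cap_apex_distinct[OF cap] by (simp add: pos_le_divide_eq) (use zero_le_dist[of ?a "p 0 (Suc 0)"] in linarith)
  then show ?case using cos_koch_angle[OF assms(1), of 0 0] i by simp
next
  case (Suc n)
  define j where "j = i div 2"
  have j: "j < 2 ^ n" "i \<in> {2 * j, Suc (2 * j)}" unfolding j_def using Suc.prems by auto
  have "cos (koch_angle p n (Suc j)) \<le> cos (koch_angle p (Suc n) (Suc i))"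
    using koch_child(2)[OF assms(1) j] koch_cap_apex[OF assms(1) j(1)] koch_cap_apex[OF assms(1) Suc.prems]
    unfolding koch_angle_def koch_apex_def by (intro cos_base_angle_antimono) auto
  then show ?case using Suc.IH[OF j(1)] by linarith
qed

section \<open>The tree of caps containing a point\<close>

text \<open>Induction over generations. Siblings meet only in their common apex. Otherwise the
  parents are neighbours meeting in one vertex, and of their children only the two adjacent to that
  vertex contain it.\<close>

lemma koch_caps_Int:
  assumes "koch_construction p" "i < j" "j < 2 ^ n"
    and "x \<in> koch_cap p n (Suc i)" "x \<in> koch_cap p n (Suc j)"
  shows "j = Suc i \<and> x = p n j"
  using assms(2-)
proof (induction n arbitrary: i j x)
  case (Suc n)
  define i' j' where "i' = i div 2" and "j' = j div 2"
  have i: "i' < 2 ^ n" "i \<in> {2 * i', Suc (2 * i')}" and j: "j' < 2 ^ n" "j \<in> {2 * j', Suc (2 * j')}"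
    unfolding i'_def j'_def using Suc.prems by auto
  have "i' \<le> j'" unfolding i'_def j'_def using Suc.prems by simp
  have sib: "koch_cap p (Suc n) (Suc (2 * m)) \<inter> koch_cap p (Suc n) (Suc (Suc (2 * m))) \<subseteq> {p (Suc n) (Suc (2 * m))}"
    if m: "m < 2 ^ n" for m
  proof -
    have e: "p (Suc n) (2 * m) = p n m" "p (Suc n) (Suc (Suc (2 * m))) = p n (Suc m)"
      using koch_vertex_even[OF assms(1), of m n] koch_vertex_even[OF assms(1), of "Suc m" n] m by auto
    have l: "2 * m < 2 ^ Suc n" "Suc (2 * m) < 2 ^ Suc n" using m by auto
    note c = koch_cap_apex[OF assms(1) m] koch_cap_apex[OF assms(1) l(1)] koch_cap_apex[OF assms(1) l(2)]
    note a = cos_koch_angle_ge[OF assms(1) m] cos_koch_angle_ge[OF assms(1) l(1)] cos_koch_angle_ge[OF assms(1) l(2)]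
    show ?thesis
      using c a
      unfolding cos_koch_angle[OF assms(1) m] cos_koch_angle[OF assms(1) l(1)] cos_koch_angle[OF assms(1) l(2)]
        koch_cap_Suc e
      by (intro sibling_caps_Int)
  qed
  show ?case
  proof (cases "i' = j'")
    case True
    then have "i = 2 * i'" "j = Suc (2 * i')" using i j Suc.prems(1) by auto
    then show ?thesis using sib[OF i(1)] Suc.prems by auto
  next
    case False
    then have "i' < j'" using \<open>i' \<le> j'\<close> by simp
    then have *: "j' = Suc i'" "x = p n j'"
      using Suc.IH[of i' j' x] Suc.prems j(1) koch_child(1)[OF assms(1) i] koch_child(1)[OF assms(1) j]
      by auto
    have x: "x = p (Suc n) (2 * j')"
      using * j(1) koch_vertex_even[OF assms(1), of j' n] by simp
    \<comment> \<open>A left child containing \<open>x\<close> would force \<open>x\<close> to be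
      the apex of the parent, since the right child also contains \<open>x\<close>; but then the
      right child would have coinciding end points.\<close>
    have "i = Suc (2 * i')"
    proof (rule ccontr)
      assume "i \<noteq> Suc (2 * i')"
      then have "i = 2 * i'" using i by auto
      moreover have "x \<in> koch_cap p (Suc n) (Suc (Suc (2 * i')))"
        unfolding koch_cap_Suc[of p "Suc n"] x *(1) by (intro hull_inc) simp
      ultimately have x': "x = p (Suc n) (Suc (2 * i'))"
        using sib[OF i(1)] Suc.prems by auto
      have "Suc (2 * i') < 2 ^ Suc n" using i(1) by simp
      from cap_apex_distinct(1)[OF koch_cap_apex[OF assms(1) this]] show False
        using x x' *(1) by simp
    qed
    moreover have "j = 2 * j'"
    proof (rule ccontr)
      assume "j \<noteq> 2 * j'"
      then have "j = Suc (2 * j')" using j by auto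
      moreover have "x \<in> koch_cap p (Suc n) (Suc (2 * j'))"
        unfolding koch_cap_Suc[of p "Suc n"] x by (intro hull_inc) simp
      ultimately have x': "x = p (Suc n) (Suc (2 * j'))"
        using sib[OF j(1)] Suc.prems by auto
      have "2 * j' < 2 ^ Suc n" using j(1) by simp
      from cap_apex_distinct(1)[OF koch_cap_apex[OF assms(1) this]] show False
        using x x' by simp
    qed
    ultimately show ?thesis using * x by simp
  qed
qed simp

lemma koch_index_cap:
  assumes "x \<in> koch_limit p"
  shows "koch_index p n x \<in> {1..2 ^ n}" "x \<in> koch_cap p n (koch_index p n x)"
    "\<And>i. i \<in> {1..2 ^ n} \<Longrightarrow> x \<in> koch_cap p n i \<Longrightarrow> i \<le> koch_index p n x"
proof -
  let ?I = "{i \<in> {1..2 ^ n}. x \<in> koch_cap p n i}"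
  have "?I \<noteq> {}" using assms unfolding koch_limit_def by blast
  then have "Max ?I \<in> ?I" by (intro Max_in) auto
  then show "koch_index p n x \<in> {1..2 ^ n}" "x \<in> koch_cap p n (koch_index p n x)"
    unfolding koch_index_def by auto
  show "i \<le> koch_index p n x" if "i \<in> {1..2 ^ n}" "x \<in> koch_cap p n i" for i
    unfolding koch_index_def using that by (intro Max_ge) auto
qed

text \<open>The parent \<open>j'\<close> of the segment chosen in generation \<open>Suc n\<close>
  also contains \<open>x\<close>, so \<open>j' \<le> i\<close> by maximality. If it were smaller,
  \<open>x\<close> would be the left end point of segment \<open>i\<close>, hence in a child of
  \<open>i\<close> with index beyond \<open>j\<close>, against the maximality of
  \<open>j\<close>.\<close>

lemma koch_index_path:
  assumes "koch_construction p" "x \<in> koch_limit p"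
  shows "koch_index p (Suc n) x - 1 \<in> {2 * (koch_index p n x - 1), Suc (2 * (koch_index p n x - 1))}"
proof -
  define i j where "i = koch_index p n x - 1" and "j = koch_index p (Suc n) x - 1"
  define j' where "j' = j div 2"
  have i: "koch_index p n x = Suc i" "i < 2 ^ n"
    using koch_index_cap(1)[OF assms(2), of n] unfolding i_def by auto
  have j: "koch_index p (Suc n) x = Suc j" "j < 2 ^ Suc n"
    using koch_index_cap(1)[OF assms(2), of "Suc n"] unfolding j_def by auto
  have j': "j' < 2 ^ n" "j \<in> {2 * j', Suc (2 * j')}" unfolding j'_def using j by auto
  have x: "x \<in> koch_cap p n (Suc i)" "x \<in> koch_cap p n (Suc j')"
    using koch_index_cap(2)[OF assms(2)] i(1) j(1) koch_child(1)[OF assms(1) j'] by (metis, metis subsetD)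
  have "j' \<le> i" using koch_index_cap(3)[OF assms(2), of "Suc j'" n] x j' i by simp
  moreover have "\<not> j' < i"
  proof
    assume "j' < i"
    then have "x = p n i" using koch_caps_Int[OF assms(1) _ i(2) x(2,1)] by simp
    also have "\<dots> = p (Suc n) (2 * i)" using koch_vertex_even[OF assms(1), of i n] i(2) by simp
    finally have "x \<in> koch_cap p (Suc n) (Suc (2 * i))"
      unfolding koch_cap_Suc by (intro hull_inc) simp
    then have "Suc (2 * i) \<le> Suc j"
      using koch_index_cap(3)[OF assms(2), of "Suc (2 * i)" "Suc n"] j i(2) by simp
    then show False using \<open>j' < i\<close> j'(2) by auto
  qed
  ultimately show ?thesis using j'(2) unfolding i_def[symmetric] j_def[symmetric] by simp
qed

text \<open>The cosine bound makes the legs shorter than the base, so a ball around either base end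
  point with the base length as radius contains the vertices and, being convex, the cap.\<close>

lemma koch_cap_dist_le:
  assumes "koch_construction p" "i < 2 ^ n" "x \<in> koch_cap p n (Suc i)" "k \<in> {i, Suc i}"
  shows "dist (p n k) x \<le> dist (p n i) (p n (Suc i))"
proof -
  let ?a = "p n i" and ?b = "p n (Suc i)" and ?c = "p (Suc n) (Suc (2 * i))"
  note c = koch_cap_apex[OF assms(1,2)]
  have "dist ?a ?c \<le> dist ?a ?b"
    using cos_koch_angle_ge[OF assms(1,2)] cap_apex_distinct[OF c] unfolding cos_koch_angle[OF assms(1,2)]
    by (simp add: field_simps) (smt (verit) zero_le_dist)
  moreover have "dist ?b ?c = dist ?a ?c" using c unfolding cap_apex_def by simp
  ultimately have "{?a, ?b, ?c} \<subseteq> cball (p n k) (dist ?a ?b)"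
    using assms(4) by (auto simp: dist_commute)
  then have "convex hull {?a, ?b, ?c} \<subseteq> cball (p n k) (dist ?a ?b)"
    by (intro hull_minimal) auto
  then show ?thesis using assms(3) unfolding koch_cap_Suc by auto
qed

text \<open>Each factor is twice the child length over the parent length, so the product telescopes
  along the branch of \<open>x\<close>.\<close>

lemma koch_partial_product:
  assumes "koch_construction p" "x \<in> koch_limit p"
  defines "k \<equiv> \<lambda>n. koch_index p n x - 1"
  shows "(\<Prod>m<n. ennreal (inverse (cos (koch_angle p m (koch_index p m x)))))
    = ennreal (2 ^ n * dist (p n (k n)) (p n (Suc (k n))) / dist (p 0 0) (p 0 1))"
proof (induction n)
  case 0
  have "k 0 = 0" using koch_index_cap(1)[OF assms(2), of 0] unfolding k_def by auto
  moreover have "p 0 0 \<noteq> p 0 1" using assms(1) unfolding koch_construction_def by blast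
  ultimately show ?case by simp
next
  case (Suc n)
  have k: "koch_index p n x = Suc (k n)" "k n < 2 ^ n"
    using koch_index_cap(1)[OF assms(2), of n] unfolding k_def by auto
  let ?d = "dist (p n (k n)) (p n (Suc (k n)))"
    and ?e = "dist (p (Suc n) (k (Suc n))) (p (Suc n) (Suc (k (Suc n))))"
  have e: "?e = dist (p n (k n)) (p (Suc n) (Suc (2 * k n)))"
    using koch_child_dist[OF assms(1) k(2)] koch_index_path[OF assms(1,2)] unfolding k_def by blast
  have "inverse (cos (koch_angle p n (koch_index p n x))) = 2 * ?e / ?d"
    unfolding k(1) cos_koch_angle[OF assms(1) k(2)] e by simp
  moreover have "?d \<noteq> 0" using cap_apex_distinct[OF koch_cap_apex[OF assms(1) k(2)]] by simp
  ultimately have "2 ^ n * ?d / dist (p 0 0) (p 0 1) * inverse (cos (koch_angle p n (koch_index p n x)))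
      = 2 ^ Suc n * ?e / dist (p 0 0) (p 0 1)"
    by simp
  moreover have "0 \<le> 2 ^ n * ?d / dist (p 0 0) (p 0 1)" by simp
  ultimately show ?case
    unfolding prod.lessThan_Suc Suc.IH by (simp only: flip: ennreal_mult')
qed

section \<open>Stopped polygons and their limit curve\<close>

text \<open>The test uses the current neighbours \<open>a\<close> and \<open>b\<close>, which may
  differ from vertices of \<open>p\<close>, and accepts \<open>c\<close> only if both new edges are
  short enough. Hence the step bound holds at every index, even beyond \<open>2 ^ n\<close>, where
  values of \<open>p\<close> are arbitrary; \<open>min i 1\<close> provides it in generation
  0.\<close>

fun stopped_vertex :: "(nat \<Rightarrow> nat \<Rightarrow> real^2) \<Rightarrow> real \<Rightarrow> nat \<Rightarrow> nat \<Rightarrow> real^2" where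
  "stopped_vertex p K 0 i = p 0 (min i 1)"
| "stopped_vertex p K (Suc n) i =
    (let a = stopped_vertex p K n (i div 2); b = stopped_vertex p K n (Suc (i div 2)); c = p (Suc n) i in
     if even i then a
     else if dist a c \<le> K / 2 ^ Suc n \<and> dist c b \<le> K / 2 ^ Suc n then c
     else midpoint a b)"

lemma stopped_vertex_step:
  assumes "dist (p 0 0) (p 0 1) \<le> K"
  shows "dist (stopped_vertex p K n i) (stopped_vertex p K n (Suc i)) \<le> K / 2 ^ n"
proof (induction n arbitrary: i)
  case 0
  have "0 \<le> K" using assms order_trans[OF zero_le_dist] by blast
  then show ?case using assms by (cases i) auto
next
  case (Suc n)
  show ?case
  proof (cases "even i")
    case True
    then show ?thesis
      using Suc.IH[of "i div 2"] by (auto simp: Let_def dist_midpoint field_simps)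
  next
    case False
    then have "Suc i div 2 = Suc (i div 2)" by simp
    then show ?thesis
      using False Suc.IH[of "i div 2"] by (auto simp: Let_def dist_midpoint field_simps)
  qed
qed

text \<open>Along the branch of a point with bounded lengths every test succeeds, so the stopped
  polygon contains the Koch segments of that branch. These shrink to the point, which is therefore
  the value of the curve at the dyadic time of the branch.\<close>

lemma koch_bounded_length_curve:
  assumes "koch_construction p" and "dist (p 0 0) (p 0 1) \<le> K"
  obtains g :: "real \<Rightarrow> real^2" where "K-lipschitz_on UNIV g"
    and "{x \<in> koch_limit p. \<forall>n. let i = koch_index p n x - 1 in
      2 ^ n * dist (p n i) (p n (Suc i)) \<le> K} \<subseteq> range g"
proof -
  let ?q = "stopped_vertex p K"
  have even: "?q (Suc n) (2 * i) = ?q n i" for n i by simp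
  have step: "dist (?q n i) (?q n (Suc i)) \<le> K / 2 ^ n" for n i
    by (rule stopped_vertex_step) (rule assms(2))
  obtain g where g: "K-lipschitz_on UNIV g"
    and lim: "\<And>t::real. (\<lambda>n. ?q n (nat \<lfloor>2 ^ n * t\<rfloor>)) \<longlonglongrightarrow> g t"
    by (rule Lipschitz_dyadic_limit[where q = ?q, OF even step], rule that)
  have "x \<in> range g" if x: "x \<in> koch_limit p"
    and short: "\<And>n. 2 ^ n * dist (p n (koch_index p n x - 1)) (p n (Suc (koch_index p n x - 1))) \<le> K" for x
  proof -
    define k where "k n = koch_index p n x - 1" for n
    have k: "koch_index p n x = Suc (k n)" "k n < 2 ^ n" for n
      using koch_index_cap(1)[OF x, of n] unfolding k_def by auto
    have path: "k (Suc n) \<in> {2 * k n, Suc (2 * k n)}" for n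
      using koch_index_path[OF assms(1) x] unfolding k_def .
    have len: "dist (p n (k n)) (p n (Suc (k n))) \<le> K / 2 ^ n" for n
      using short[of n] unfolding k_def by (simp add: field_simps)
    \<comment> \<open>Both end points are carried along because the test for the next apex involves
      both.\<close>
    have qp: "?q n (k n) = p n (k n) \<and> ?q n (Suc (k n)) = p n (Suc (k n))" for n
    proof (induction n)
      case 0
      then show ?case using k(2)[of 0] by simp
    next
      case (Suc n)
      have e: "p (Suc n) (2 * k n) = p n (k n)" "p (Suc n) (Suc (Suc (2 * k n))) = p n (Suc (k n))"
        using koch_vertex_even[OF assms(1), of "k n" n] koch_vertex_even[OF assms(1), of "Suc (k n)" n] k(2)[of n]
        by auto
      \<comment> \<open>The length bound is known only for the child on the branch; its sibling is
        equally long, so both conditions of the test hold.\<close>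
      have "dist (p n (k n)) (p (Suc n) (Suc (2 * k n))) \<le> K / 2 ^ Suc n"
        using len[of "Suc n"] koch_child_dist[OF assms(1) k(2) path] by simp
      moreover have "dist (p (Suc n) (Suc (2 * k n))) (p n (Suc (k n))) \<le> K / 2 ^ Suc n"
        using calculation koch_cap_apex[OF assms(1) k(2)[of n]] unfolding cap_apex_def
        by (simp add: dist_commute)
      ultimately have "?q (Suc n) (Suc (2 * k n)) = p (Suc n) (Suc (2 * k n))"
        using Suc.IH by (simp add: Let_def)
      moreover have "?q (Suc n) (2 * k n) = p (Suc n) (2 * k n)"
        "?q (Suc n) (Suc (Suc (2 * k n))) = p (Suc n) (Suc (Suc (2 * k n)))"
        using Suc.IH e by (simp_all add: Let_def)
      ultimately show ?case using path[of n] by (auto simp del: stopped_vertex.simps)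
    qed
    obtain t :: real where t: "\<And>n. nat \<lfloor>2 ^ n * t\<rfloor> \<in> {k n, Suc (k n)}"
      using dyadic_path_point[of k, OF path] by metis
    have bound: "dist (?q n (nat \<lfloor>2 ^ n * t\<rfloor>)) x \<le> K * (1/2) ^ n" for n
    proof -
      have "?q n (nat \<lfloor>2 ^ n * t\<rfloor>) = p n (nat \<lfloor>2 ^ n * t\<rfloor>)" using t[of n] qp[of n] by auto
      moreover have "dist (p n (nat \<lfloor>2 ^ n * t\<rfloor>)) x \<le> dist (p n (k n)) (p n (Suc (k n)))"
        using koch_cap_dist_le[OF assms(1) k(2) _ t] koch_index_cap(2)[OF x, of n] k(1) by simp
      ultimately have "dist (?q n (nat \<lfloor>2 ^ n * t\<rfloor>)) x \<le> K / 2 ^ n"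
        using len[of n] by (simp only: order_trans)
      then show ?thesis by (simp add: power_one_over)
    qed
    have bound_0: "(\<lambda>n. K * (1/2) ^ n) \<longlonglongrightarrow> 0"
      by (intro tendsto_mult_right_zero LIMSEQ_realpow_zero) auto
    have "(\<lambda>n. dist (?q n (nat \<lfloor>2 ^ n * t\<rfloor>)) x) \<longlonglongrightarrow> 0"
      by (rule real_tendsto_sandwich[OF always_eventually always_eventually tendsto_const bound_0])
        (rule allI, rule zero_le_dist, rule allI, rule bound)
    then have "(\<lambda>n. ?q n (nat \<lfloor>2 ^ n * t\<rfloor>)) \<longlonglongrightarrow> x"
      by (rule iffD2[OF tendsto_dist_iff])
    then have "g t = x" using LIMSEQ_unique[OF lim] by blast
    then show ?thesis by blast
  qed
  then have "{x \<in> koch_limit p. \<forall>n. let i = koch_index p n x - 1 in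
      2 ^ n * dist (p n i) (p n (Suc i)) \<le> K} \<subseteq> range g"
    by (auto simp: Let_def)
  with g that show ?thesis by blast
qed

section \<open>Finite products and the conclusion\<close>

lemma koch_product_finite_bound:
  assumes "koch_construction p" "x \<in> koch_limit p" "koch_product p x \<noteq> \<infinity>"
  obtains M :: nat where
    "\<And>n. let i = koch_index p n x - 1 in
      2 ^ n * dist (p n i) (p n (Suc i)) \<le> real (Suc M) * dist (p 0 0) (p 0 1)"
proof -
  define L where "L = dist (p 0 0) (p 0 1)"
  have L: "L > 0" using assms(1) unfolding L_def koch_construction_def by auto
  let ?f = "\<lambda>n. ennreal (inverse (cos (koch_angle p n (koch_index p n x))))"
  let ?d = "\<lambda>n. dist (p n (koch_index p n x - 1)) (p n (Suc (koch_index p n x - 1)))"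
  have "1 \<le> ?f n" for n
  proof -
    have i: "koch_index p n x = Suc (koch_index p n x - 1)" "koch_index p n x - 1 < 2 ^ n"
      using koch_index_cap(1)[OF assms(2), of n] by auto
    have "1 \<le> inverse (cos (koch_angle p n (koch_index p n x)))"
      using cos_koch_angle_ge[OF assms(1) i(2)] i(1) by (intro one_le_inverse) auto
    then show ?thesis by (metis ennreal_1 ennreal_leI)
  qed
  then have sup: "koch_product p x = (SUP n. \<Prod>m\<le>n. ?f m)"
    unfolding koch_product_def by (rule prodinf_ennreal_eq_SUP)
  obtain M :: nat where M: "koch_product p x < of_nat M"
    using assms(3) by (metis ennreal_Ex_less_of_nat infinity_ennreal_def less_top)
  \<comment> \<open>Generation \<open>Suc m\<close> corresponds to the partial product up to
    \<open>m\<close>. Generation 0 has no such product, and the factor \<open>Suc M\<close>, being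
    at least 1, settles it directly.\<close>
  have "2 ^ n * ?d n \<le> real (Suc M) * L" for n
  proof (cases n)
    case 0
    have "koch_index p 0 x - 1 = 0" using koch_index_cap(1)[OF assms(2), of 0] by auto
    then show ?thesis using 0 L unfolding L_def by simp
  next
    case (Suc m)
    have "ennreal (2 ^ n * ?d n / L) = (\<Prod>m<n. ?f m)"
      unfolding L_def using koch_partial_product[OF assms(1,2)] by simp
    also have "\<dots> = (\<Prod>m\<le>m. ?f m)" unfolding Suc lessThan_Suc_atMost ..
    also have "\<dots> \<le> koch_product p x" unfolding sup by (rule SUP_upper) simp
    also have "\<dots> \<le> ennreal (real M)" using M by (simp add: ennreal_of_nat_eq_real_of_nat)
    finally have "2 ^ n * ?d n / L \<le> real M" by simp
    then have "2 ^ n * ?d n \<le> real M * L" using L by (simp add: field_simps)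
    also have "\<dots> \<le> real (Suc M) * L" using L by simp
    finally show ?thesis .
  qed
  then show ?thesis using that unfolding L_def Let_def by blast
qed

theorem theorem8p3:
  fixes p :: "nat \<Rightarrow> nat \<Rightarrow> real^2" and A :: "(real^2) set"
  assumes "koch_type_set p A"
    and "hausdorff1 (koch_Lambda_infinity p A) = 0"
  shows "countably_1_rectifiable A"
proof -
  let ?L = "dist (p 0 0) (p 0 1)"
  have p: "koch_construction p" and A: "A \<subseteq> koch_limit p"
    using assms(1) unfolding koch_type_set_def by blast+
  \<comment> \<open>The curve lemma requires a constant no smaller than the length of the initial
    segment; \<open>Suc M\<close> ensures this also for \<open>M = 0\<close>.\<close>
  have L: "?L \<le> real (Suc M) * ?L" for M by (simp add: distrib_right)
  define S where "S M = {x \<in> koch_limit p. \<forall>n. let i = koch_index p n x - 1 in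
      2 ^ n * dist (p n i) (p n (Suc i)) \<le> real (Suc M) * ?L}" for M
  have "\<exists>g :: real \<Rightarrow> real^2. (real (Suc M) * ?L)-lipschitz_on UNIV g \<and> S M \<subseteq> range g" for M
    unfolding S_def by (rule koch_bounded_length_curve[OF p L[of M]]) blast
  then obtain F :: "nat \<Rightarrow> real \<Rightarrow> real^2"
    where F: "\<And>M. (real (Suc M) * ?L)-lipschitz_on UNIV (F M)" "\<And>M. S M \<subseteq> range (F M)"
    by metis
  have "A \<subseteq> koch_Lambda_infinity p A \<union> (\<Union>j. range (F j))"
  proof
    fix x
    assume x: "x \<in> A"
    show "x \<in> koch_Lambda_infinity p A \<union> (\<Union>j. range (F j))"
    proof (cases "koch_product p x = \<infinity>")
      case True
      then show ?thesis using x unfolding koch_Lambda_infinity_def by simp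
    next
      case False
      then obtain M where "x \<in> S M"
        using koch_product_finite_bound[OF p] x A unfolding S_def by blast
      then show ?thesis using F(2) by blast
    qed
  qed
  moreover have "\<exists>L. L-lipschitz_on UNIV (F j)" for j using F(1) by blast
  ultimately show ?thesis
    unfolding countably_1_rectifiable_def using assms(2)
    by (intro exI[of _ "koch_Lambda_infinity p A"] exI[of _ F]) simp
qed

end
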